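(* Let $R$ be an integral domain with quotient field $K$. The following are equivalent. (1) Every nonconstant irreducible polynomial $f \in R[x]$ is irreducible in $K[x]$. (2) $R[x]$ is an AP-domain. (3) $R[x]$ is a GL-domain. (4) Each of the following holds: ($\alpha$) $R$ has the PSP-property; ($\beta$) $R$ is integrally closed; and ($\gamma$) whenever $B, C$ are finitely generated (nonzero) fractional ideals of $R$ such that $(BC)_v = R$, then $B_v$ is principal.
   Context: For an integral domain $D$, an atom is an irreducible element (a nonzero nonunit that is not a product of two nonunits). $D$ is an AP-domain if every atom of $D$ is prime. A polynomial over $D$ (in one indeterminate) is primitive if the only common divisors in $D$ of its coefficients are units of $D$. $D$ is a GL-domain (has the GL-property) if the product of any two primitive polynomials over $D$ is primitive; for $D = R[x]$ this refers to polynomials in a new indeterminate with coefficients in $R[x]$. For a nonzero fractional ideal $F$ of $R$, $F^{-1} = \{z \in K : zF \subseteq R\}$ and $F_v = (F^{-1})^{-1}$. $R$ has the PSP-property if whenever $a_0 + a_1x + \cdots + a_nx^n$ is a primitive polynomial over $R$ and $z \in (a_0, a_1, \ldots, a_n)^{-1}$ (that is, $z \in K$ with $za_i \in R$ for all $i$), then $z \in R$. *)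

theory Defs
  imports "HOL-Computational_Algebra.Computational_Algebra"
begin

text \<open>
  The integral domain \<open>R\<close> is the type \<^typ>\<open>'a::idom\<close>, its quotient field \<open>K\<close> is \<^typ>\<open>'a fract\<close>,
  and \<open>R\<close> sits inside \<open>K\<close> as \<^term>\<open>range to_fract\<close>. Properties of a domain as a whole are predicates
  on \<^typ>\<open>'a itself\<close>, so that they can be applied to \<open>TYPE('a poly)\<close>, that is, to \<open>R[x]\<close>.
\<close>

definition AP_domain :: "'a::idom itself \<Rightarrow> bool" where
  "AP_domain _ \<longleftrightarrow> (\<forall>p::'a. irreducible p \<longrightarrow> prime_elem p)"

text \<open>
  The library's \<^const>\<open>content\<close> needs gcds, so primitivity is stated by common divisors. The
  coefficients above the degree are 0 and impose no condition on a common divisor. The zero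
  polynomial is not primitive, because 0 is a common divisor of its coefficients.
\<close>

definition primitive_poly :: "'a::idom poly \<Rightarrow> bool" where
  "primitive_poly p \<longleftrightarrow> (\<forall>c. (\<forall>i. c dvd coeff p i) \<longrightarrow> c dvd 1)"

definition GL_domain :: "'a::idom itself \<Rightarrow> bool" where
  "GL_domain _ \<longleftrightarrow>
     (\<forall>p q :: 'a poly. primitive_poly p \<longrightarrow> primitive_poly q \<longrightarrow> primitive_poly (p * q))"

definition integral_elem :: "'a::idom fract \<Rightarrow> bool" where
  "integral_elem x \<longleftrightarrow> (\<exists>p :: 'a poly. lead_coeff p = 1 \<and> poly (fract_poly p) x = 0)"

definition integrally_closed :: "'a::idom itself \<Rightarrow> bool" where
  "integrally_closed _ \<longleftrightarrow> (\<forall>x :: 'a fract. integral_elem x \<longrightarrow> x \<in> range to_fract)"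

text \<open>
  \<open>K\<close> as an \<open>R\<close>-module: \<open>fract_module.subspace\<close> means \<open>R\<close>-submodule of \<open>K\<close>, and
  \<open>fract_module.span S\<close> is the \<open>R\<close>-submodule of \<open>K\<close> generated by \<open>S\<close>.
\<close>

definition fract_scale :: "'a::idom \<Rightarrow> 'a fract \<Rightarrow> 'a fract" where
  "fract_scale r x = to_fract r * x"

global_interpretation fract_module: module "fract_scale :: 'a::idom \<Rightarrow> 'a fract \<Rightarrow> 'a fract"
  by unfold_locales (simp_all add: fract_scale_def algebra_simps)

definition fractional_ideal :: "'a::idom fract set \<Rightarrow> bool" where
  "fractional_ideal F \<longleftrightarrow> fract_module.subspace F \<and>
     (\<exists>d. d \<noteq> 0 \<and> (\<forall>x\<in>F. fract_scale d x \<in> range to_fract))"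

definition fin_gen_fractional_ideal :: "'a::idom fract set \<Rightarrow> bool" where
  "fin_gen_fractional_ideal F \<longleftrightarrow>
     fractional_ideal F \<and> (\<exists>S. finite S \<and> F = fract_module.span S)"

definition principal_fractional_ideal :: "'a::idom fract set \<Rightarrow> bool" where
  "principal_fractional_ideal F \<longleftrightarrow> (\<exists>x. F = fract_module.span {x})"

definition ideal_prod :: "'a::idom fract set \<Rightarrow> 'a fract set \<Rightarrow> 'a fract set" where
  "ideal_prod B C = fract_module.span {b * c | b c. b \<in> B \<and> c \<in> C}"

definition ideal_inverse :: "'a::idom fract set \<Rightarrow> 'a fract set" where
  "ideal_inverse F = {z. \<forall>y\<in>F. z * y \<in> range to_fract}"

definition v_closure :: "'a::idom fract set \<Rightarrow> 'a fract set" where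
  "v_closure F = ideal_inverse (ideal_inverse F)"

definition PSP_property :: "'a::idom itself \<Rightarrow> bool" where
  "PSP_property _ \<longleftrightarrow>
     (\<forall>p :: 'a poly. primitive_poly p \<longrightarrow>
        (\<forall>z \<in> ideal_inverse (fract_module.span ((\<lambda>i. to_fract (coeff p i)) ` {..degree p})).
           z \<in> range to_fract))"

end

theory Submission
  imports Defs
begin

text \<open>
  Everything is compared with a Gauss property: whenever a primitive polynomial over \<open>R\<close> factors
  as \<open>pq\<close> over \<open>K\<close>, some \<open>c \<noteq> 0\<close> makes \<open>cp\<close> and \<open>c\<^sup>-\<^sup>1q\<close> polynomials over \<open>R\<close>.
  Under (1) it follows by splitting off irreducible factors, which are prime in \<open>K[x]\<close>.

  The Gauss property gives PSP when applied to \<open>x\<^sup>mf + zf = (x\<^sup>m + z)f\<close>, integral closedness when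
  applied to a monic polynomial with a linear factor, and \<open>(\<gamma>)\<close> when applied to \<open>p(x)q(x\<^sup>N)\<close> with
  \<open>N\<close> large, whose coefficients are the products of the generators of \<open>B\<close> and \<open>C\<close>. Conversely, if
  \<open>R\<close> is integrally closed and \<open>pq\<close> lies in \<open>R[x]\<close>, then all products of a coefficient of \<open>p\<close> and one
  of \<open>q\<close> lie in \<open>R\<close>, because this holds in every valuation ring between \<open>R\<close> and \<open>K\<close>; together with
  PSP, the content ideals \<open>B\<close> and \<open>C\<close> of \<open>p\<close> and \<open>q\<close> satisfy \<open>(BC)\<^sub>v = R\<close>, and a generator of \<open>B\<^sub>v\<close>
  yields \<open>c\<close>.

  For GL over \<open>R[x]\<close>, a common divisor \<open>h\<close> of the coefficients of a product of primitive \<open>F\<close>, \<open>G\<close> is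
  primitive by the substitution \<open>y = x\<^sup>N\<close>, and a nonconstant irreducible factor of \<open>h\<close> would be prime
  in \<open>K[x]\<close> and hence divide all coefficients of \<open>F\<close> or all of \<open>G\<close>, first over \<open>K\<close> and then over \<open>R\<close>.
  GL implies AP because \<open>(a + by)(a + cy)\<close> is not primitive if \<open>a\<close> divides \<open>bc\<close>.
\<close>

section \<open>Subrings of fields and valuation rings\<close>

definition is_subring :: "'a::comm_ring_1 set \<Rightarrow> bool" where
  "is_subring S \<longleftrightarrow> 1 \<in> S \<and> (\<forall>x\<in>S. \<forall>y\<in>S. x - y \<in> S \<and> x * y \<in> S)"

lemma is_subring_1: "is_subring S \<Longrightarrow> 1 \<in> S"
  and is_subring_diff: "is_subring S \<Longrightarrow> x \<in> S \<Longrightarrow> y \<in> S \<Longrightarrow> x - y \<in> S"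
  and is_subring_mult: "is_subring S \<Longrightarrow> x \<in> S \<Longrightarrow> y \<in> S \<Longrightarrow> x * y \<in> S"
  by (auto simp: is_subring_def)

lemma is_subring_0: "is_subring S \<Longrightarrow> 0 \<in> S"
  using is_subring_diff[of S 1 1] by (simp add: is_subring_1)

lemma is_subring_add:
  assumes "is_subring S" "x \<in> S" "y \<in> S"
  shows "x + y \<in> S"
  using is_subring_diff[OF assms(1,2) is_subring_diff[OF assms(1) is_subring_0 assms(3)]] assms(1)
  by simp

lemma is_subring_sum: "is_subring S \<Longrightarrow> (\<And>i. i \<in> I \<Longrightarrow> f i \<in> S) \<Longrightarrow> sum f I \<in> S"
  by (induction I rule: infinite_finite_induct) (auto intro: is_subring_add is_subring_0)

lemma is_subring_power: "is_subring S \<Longrightarrow> x \<in> S \<Longrightarrow> x ^ n \<in> S"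
  by (induction n) (auto intro: is_subring_mult is_subring_1)

lemma is_subring_Union_chain:
  assumes "C \<noteq> {}" "\<And>S. S \<in> C \<Longrightarrow> is_subring S" "subset.chain A C"
  shows "is_subring (\<Union>C)"
proof -
  have "\<exists>S\<in>C. x \<in> S \<and> y \<in> S" if "x \<in> \<Union>C" "y \<in> \<Union>C" for x y
    using that assms(3) unfolding subset.chain_def by blast
  then show ?thesis
    using assms(1,2) unfolding is_subring_def by (meson Union_iff equals0I)
qed

section \<open>Polynomials over a subring, and adjoining an element\<close>

definition polys_over :: "'a::comm_ring_1 set \<Rightarrow> 'a poly set" where
  "polys_over S = {p. \<forall>i. coeff p i \<in> S}"

lemma is_subring_polys_over: "is_subring S \<Longrightarrow> is_subring (polys_over S)"
  unfolding is_subring_def[of "polys_over S"]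
  by (auto simp: polys_over_def coeff_mult is_subring_0 is_subring_1
      intro!: is_subring_diff is_subring_sum is_subring_mult)

lemma monom_in_polys_over: "is_subring S \<Longrightarrow> c \<in> S \<Longrightarrow> monom c n \<in> polys_over S"
  by (simp add: polys_over_def is_subring_0)

lemma smult_in_polys_over: "is_subring S \<Longrightarrow> c \<in> S \<Longrightarrow> p \<in> polys_over S \<Longrightarrow> smult c p \<in> polys_over S"
  by (simp add: polys_over_def is_subring_mult)

lemma reflect_poly_in_polys_over: "is_subring S \<Longrightarrow> p \<in> polys_over S \<Longrightarrow> reflect_poly p \<in> polys_over S"
  by (simp add: polys_over_def coeff_reflect_poly is_subring_0)

definition adjoin :: "'a::comm_ring_1 set \<Rightarrow> 'a \<Rightarrow> 'a set" where
  "adjoin S u = (\<lambda>p. poly p u) ` polys_over S"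

lemma adjoinI: "p \<in> polys_over S \<Longrightarrow> poly p u \<in> adjoin S u"
  by (simp add: adjoin_def)

lemma is_subring_adjoin:
  assumes "is_subring S"
  shows "is_subring (adjoin S u)"
proof -
  note S = is_subring_polys_over[OF assms]
  have "1 \<in> adjoin S u"
    using adjoinI[OF is_subring_1[OF S]] by simp
  moreover have "x - y \<in> adjoin S u \<and> x * y \<in> adjoin S u"
    if "x \<in> adjoin S u" "y \<in> adjoin S u" for x y
    using that adjoinI[OF is_subring_diff[OF S]] adjoinI[OF is_subring_mult[OF S]]
    by (auto simp: adjoin_def)
  ultimately show ?thesis
    by (simp add: is_subring_def)
qed

lemma subset_adjoin: "is_subring S \<Longrightarrow> S \<subseteq> adjoin S u"
  using adjoinI[OF monom_in_polys_over[of S _ 0], of _ u] by (auto simp: poly_monom)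

lemma in_adjoin: "is_subring S \<Longrightarrow> u \<in> adjoin S u"
  using adjoinI[OF monom_in_polys_over[of S 1 1], of u] by (simp add: poly_monom is_subring_1)

section \<open>Existence of a valuation ring that avoids a given element\<close>

definition is_valuation_ring :: "'a::field set \<Rightarrow> bool" where
  "is_valuation_ring V \<longleftrightarrow> is_subring V \<and> (\<forall>u. u \<in> V \<or> inverse u \<in> V)"

text \<open>Zorn's lemma applies because the union of a chain of subrings omitting z omits z.
  Maximality is used later in this form: adjoining any element outside \<open>V\<close> captures
  z.\<close>

lemma exists_maximal_subring_avoiding:
  fixes S :: "'a::comm_ring_1 set"
  assumes "is_subring S" "z \<notin> S"
  obtains V where "is_subring V" "S \<subseteq> V" "z \<notin> V"
    "\<And>W. is_subring W \<Longrightarrow> V \<subset> W \<Longrightarrow> z \<in> W"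
proof -
  define A where "A = {V. is_subring V \<and> S \<subseteq> V \<and> z \<notin> V}"
  have "\<exists>M\<in>A. \<forall>X\<in>A. M \<subseteq> X \<longrightarrow> X = M"
  proof (rule subset_Zorn_nonempty)
    show "A \<noteq> {}"
      using assms by (auto simp: A_def)
  next
    fix C assume C: "C \<noteq> {}" "subset.chain A C"
    then have "C \<subseteq> A"
      by (simp add: subset.chain_def)
    with C is_subring_Union_chain[OF C(1) _ C(2)] show "\<Union>C \<in> A"
      unfolding A_def by blast
  qed
  then obtain V where "V \<in> A" "\<And>X. X \<in> A \<Longrightarrow> V \<subseteq> X \<Longrightarrow> X = V"
    by blast
  then show thesis
    by (intro that[of V]) (auto simp: A_def)
qed

text \<open>If \<open>q\<^sub>0\<close> is the constant term of \<open>q\<close>, then \<open>1 - q\<^sub>0/z\<close> is a unit of \<open>V\<close>. So the representation of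
  \<open>z\<close> by powers of \<open>1/u\<close> expresses the leading power of \<open>u\<close> in the other one by lower powers.\<close>

lemma lower_degree_representation:
  fixes V :: "'a::field set"
  assumes V: "is_subring V" and loc: "\<And>t. t \<in> V \<Longrightarrow> inverse (1 - inverse z * t) \<in> V"
    and yV: "inverse z \<in> V" and zV: "z \<notin> V"
    and u: "u \<noteq> 0"
    and p: "p \<in> polys_over V" "poly p u = z"
    and q: "q \<in> polys_over V" "poly q (inverse u) = z"
    and deg: "degree q \<le> degree p"
  shows "\<exists>p'\<in>polys_over V. poly p' u = z \<and> degree p' < degree p"
proof -
  define n where "n = degree p"
  define y where "y = inverse z"
  have "z \<noteq> 0"
    using zV is_subring_0[OF V] by auto
  obtain q0 r where q_eq: "q = pCons q0 r"
    by (cases q)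
  have coeffs: "q0 \<in> V" "r \<in> polys_over V"
    using q(1) by (auto simp: q_eq polys_over_def coeff_pCons split: nat.splits)
  have "r \<noteq> 0"
    using q(2) coeffs zV by (auto simp: q_eq)
  then have "degree r < n"
    using deg by (simp add: q_eq n_def)
  define w where "w = inverse (1 - y * q0)"
  have w: "w \<in> V"
    using loc coeffs by (simp add: w_def y_def)
  have "y * q0 \<noteq> 1"
    using zV coeffs \<open>z \<noteq> 0\<close> by (auto simp: y_def field_simps)
  have "z = q0 + inverse u * poly r (inverse u)"
    using q(2) by (simp add: q_eq)
  then have "1 - y * q0 = y * (inverse u * poly r (inverse u))"
    using \<open>z \<noteq> 0\<close> by (simp add: y_def field_simps)
  then have one: "1 = w * y * (inverse u * poly r (inverse u))"
    using \<open>y * q0 \<noteq> 1\<close> by (simp add: w_def mult.assoc flip: \<open>1 - y * q0 = _\<close>)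
  define k where "k = n - 1 - degree r"
  have n: "n = Suc (degree r + k)"
    using \<open>degree r < n\<close> by (simp add: k_def)
  \<comment> \<open>Multiplying \<open>one\<close> by \<open>u ^ n\<close> clears the powers of 1/u:
    reversing r does so for r(1/u), and the monomial supplies the remaining exponent. So
    \<open>s\<close> has the value \<open>u ^ n\<close> at u, although its degree is below
    n.\<close>
  define s where "s = smult (w * y) (monom 1 k * reflect_poly r)"
  have s: "s \<in> polys_over V"
    unfolding s_def y_def
    by (intro smult_in_polys_over V is_subring_mult[OF V] w yV monom_in_polys_over is_subring_1
        is_subring_mult[OF is_subring_polys_over[OF V]] reflect_poly_in_polys_over coeffs)
  have "degree s \<le> k + degree (reflect_poly r)"
    unfolding s_def
    by (rule order.trans[OF degree_smult_le]) (meson add_mono degree_monom_le degree_mult_le order.trans order_refl)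
  then have deg_s: "degree s < n"
    using degree_reflect_poly_le[of r] by (simp add: n)
  have "poly s u = w * y * (u ^ k * (u ^ degree r * poly r (inverse u)))"
    using u by (simp add: s_def poly_monom poly_reflect_poly_nz)
  also have "\<dots> = u ^ n * (w * y * (inverse u * poly r (inverse u)))"
    using u by (simp add: n power_add field_simps)
  also have "\<dots> = u ^ n"
    by (simp flip: one)
  finally have poly_s: "poly s u = u ^ n" .
  \<comment> \<open>Trading the leading monomial of p for a multiple of s keeps the value at u and
    lowers the degree.\<close>
  define p' where "p' = (p - monom (coeff p n) n) + smult (coeff p n) s"
  have "coeff p n \<in> V"
    using p by (simp add: polys_over_def)
  then have "p' \<in> polys_over V"
    unfolding p'_def
    by (intro is_subring_add is_subring_diff is_subring_polys_over V p monom_in_polys_over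
        smult_in_polys_over s)
  moreover have "poly p' u = z"
    by (simp add: p'_def poly_monom poly_s p)
  moreover have "degree p' < n"
  proof -
    have "degree p' \<le> n - 1"
    proof (rule degree_le, intro allI impI)
      fix i assume "n - 1 < i"
      then consider "i = n" | "i > n"
        by linarith
      then show "coeff p' i = 0"
        using deg_s by cases (auto simp: p'_def coeff_eq_0 n_def)
    qed
    then show ?thesis
      by (simp add: n)
  qed
  ultimately show ?thesis
    by (auto simp: n_def)
qed

text \<open>A subring \<open>V\<close> containing S[1/z] and maximal among those omitting z works:
  if u and 1/u were both outside \<open>V\<close>, maximality would make z a polynomial over
  \<open>V\<close> in u and also in 1/u, and \<open>lower_degree_representation\<close> would
  shorten these representations forever.\<close>

lemma exists_valuation_ring_avoiding:
  fixes S :: "'a::field set"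
  assumes S: "is_subring S" and z: "z \<notin> adjoin S (inverse z)"
  obtains V where "is_valuation_ring V" "S \<subseteq> V" "z \<notin> V"
proof -
  obtain V where V: "is_subring V" "adjoin S (inverse z) \<subseteq> V" "z \<notin> V"
    and max: "\<And>W. is_subring W \<Longrightarrow> V \<subset> W \<Longrightarrow> z \<in> W"
    using exists_maximal_subring_avoiding[OF is_subring_adjoin[OF S] z] by metis
  have yV: "inverse z \<in> V" and "S \<subseteq> V"
    using V(2) in_adjoin[OF S] subset_adjoin[OF S] by blast+
  have ext: "z \<in> adjoin V u" if "u \<notin> V" for u
    using max[OF is_subring_adjoin[OF V(1)], of u] subset_adjoin[OF V(1)] in_adjoin[OF V(1)] that
    by blast
  have "z \<noteq> 0"
    using V is_subring_0 by blast
  \<comment> \<open>Otherwise z is a polynomial in 1/e over \<open>V\<close>, so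
    \<open>e ^ n * z\<close> lies in \<open>V\<close> for some n. Since e z = z - t, the factors e
    can be removed one at a time, which puts z into \<open>V\<close>.\<close>
  have loc: "inverse (1 - inverse z * t) \<in> V" if t: "t \<in> V" for t
  proof (rule ccontr)
    define e where "e = 1 - inverse z * t"
    have eV: "e \<in> V"
      unfolding e_def by (intro is_subring_diff is_subring_mult is_subring_1 V yV t)
    have e0: "e \<noteq> 0"
      using V t \<open>z \<noteq> 0\<close> by (auto simp: e_def field_simps)
    assume "inverse (1 - inverse z * t) \<notin> V"
    then obtain p where p: "p \<in> polys_over V" "z = poly p (inverse e)"
      using ext by (auto simp: adjoin_def e_def)
    have "poly (reflect_poly p) e \<in> V"
      using reflect_poly_in_polys_over[OF V(1) p(1)] eV
      by (auto simp: poly_altdef polys_over_def intro!: is_subring_sum is_subring_mult is_subring_power V)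
    then have 1: "e ^ degree p * z \<in> V"
      using e0 p by (simp add: poly_reflect_poly_nz)
    have 2: "e ^ n * z \<in> V \<Longrightarrow> z \<in> V" for n
    proof (induction n)
      case (Suc n)
      have "e ^ n * z = e ^ Suc n * z + t * e ^ n"
        using \<open>z \<noteq> 0\<close> by (simp add: e_def field_simps)
      moreover have "e ^ Suc n * z + t * e ^ n \<in> V"
        by (intro is_subring_add[OF V(1) Suc.prems] is_subring_mult is_subring_power V t eV)
      ultimately show ?case
        using Suc.IH by simp
    qed simp
    from 1 2 V show False
      by blast
  qed
  have "u \<in> V \<or> inverse u \<in> V" for u
  proof (rule ccontr)
    assume "\<not> (u \<in> V \<or> inverse u \<in> V)"
    then have u: "u \<notin> V" "inverse u \<notin> V" "u \<noteq> 0"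
      using is_subring_0[OF V(1)] by auto
    \<comment> \<open>Descent on the sum of the two degrees: a representation of maximal degree is
      shortened, with u and 1/u exchanged in the second case.\<close>
    have False if "p \<in> polys_over V" "q \<in> polys_over V" "poly p u = z" "poly q (inverse u) = z" for p q
      using that
    proof (induction "degree p + degree q" arbitrary: p q rule: less_induct)
      case less
      show ?case
      proof (cases "degree q \<le> degree p")
        case True
        obtain p' where "p' \<in> polys_over V" "poly p' u = z" "degree p' < degree p"
          using lower_degree_representation[OF V(1) loc yV V(3) u(3) less.prems(1,3,2,4) True] by blast
        with less.hyps[of p' q] less.prems show ?thesis
          by simp
      next
        case False
        then have "\<exists>q'\<in>polys_over V. poly q' (inverse u) = z \<and> degree q' < degree q"
          using less.prems u
          by (intro lower_degree_representation[OF V(1) loc yV V(3), where q = p]) auto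
        then obtain q' where "q' \<in> polys_over V" "poly q' (inverse u) = z" "degree q' < degree q"
          by blast
        with less.hyps[of p q'] less.prems show ?thesis
          by simp
      qed
    qed
    then show False
      using ext[OF u(1)] ext[OF u(2)] unfolding adjoin_def by (metis imageE)
  qed
  with V \<open>S \<subseteq> V\<close> show thesis
    by (intro that[of V]) (auto simp: is_valuation_ring_def)
qed

section \<open>Gauss's lemma over valuation rings\<close>

lemma is_valuation_ring_subring: "is_valuation_ring V \<Longrightarrow> is_subring V"
  by (simp add: is_valuation_ring_def)

text \<open>Divisibility over \<open>V\<close> is total on nonzero elements, so a finite set of them
  contains one that divides all the others.\<close>

lemma valuation_ring_exists_greatest:
  assumes V: "is_valuation_ring V" and "finite A" "A \<noteq> {}" "0 \<notin> A"
  shows "\<exists>c\<in>A. \<forall>a\<in>A. a / c \<in> V"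
  using assms(2-)
proof (induction rule: finite_ne_induct)
  case (singleton x)
  then show ?case
    using is_subring_1[OF is_valuation_ring_subring[OF V]] by auto
next
  case (insert x F)
  then obtain c where c: "c \<in> F" "\<And>a. a \<in> F \<Longrightarrow> a / c \<in> V"
    by auto
  have nz: "c \<noteq> 0" "x \<noteq> 0"
    using insert.prems c(1) by auto
  show ?case
  proof (cases "x / c \<in> V")
    case True
    with c show ?thesis by auto
  next
    case False
    have "inverse (x / c) \<in> V"
      using V False by (auto simp: is_valuation_ring_def)
    then have "c / x \<in> V"
      by (simp add: field_simps)
    then have "a / x \<in> V" if "a \<in> F" for a
      using is_subring_mult[OF is_valuation_ring_subring[OF V] c(2)[OF that], of "c / x"] nz by simp
    then show ?thesis
      using nz is_subring_1[OF is_valuation_ring_subring[OF V]] by auto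
  qed
qed

lemma valuation_ring_normalize_poly:
  assumes V: "is_valuation_ring V" and "p \<noteq> 0"
  obtains c p' i where "c \<noteq> 0" "p = smult c p'" "p' \<in> polys_over V" "coeff p' i = 1"
proof -
  define A where "A = coeff p ` {..degree p} - {0}"
  have "finite A" "A \<noteq> {}" "0 \<notin> A"
    using \<open>p \<noteq> 0\<close> by (auto simp: A_def)
  then obtain c where c: "c \<in> A" "\<And>a. a \<in> A \<Longrightarrow> a / c \<in> V"
    using valuation_ring_exists_greatest[OF V, of A] by blast
  have "coeff p i / c \<in> V" for i
  proof (cases "coeff p i = 0")
    case True
    then show ?thesis
      by (simp add: is_subring_0 is_valuation_ring_subring V)
  next
    case False
    then show ?thesis
      using le_degree[of p i] by (intro c(2)) (auto simp: A_def)
  qed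
  moreover obtain i where "coeff p i = c" "c \<noteq> 0"
    using c(1) by (auto simp: A_def)
  ultimately show thesis
    by (intro that[of c "smult (inverse c) p" i]) (auto simp: polys_over_def field_simps)
qed

definition units_of_subring :: "'a::field set \<Rightarrow> 'a set" where
  "units_of_subring V = {u \<in> V. u \<noteq> 0 \<and> inverse u \<in> V}"

lemma units_of_subring_mult:
  "is_subring V \<Longrightarrow> u \<in> units_of_subring V \<Longrightarrow> v \<in> units_of_subring V \<Longrightarrow> u * v \<in> units_of_subring V"
  by (auto simp: units_of_subring_def is_subring_mult)

lemma nonunits_mult:
  assumes V: "is_subring V" and "a \<in> V" "v \<in> V" "a \<notin> units_of_subring V"
  shows "a * v \<notin> units_of_subring V"
proof
  assume "a * v \<in> units_of_subring V"
  then have "a \<noteq> 0" "v \<noteq> 0" "inverse (a * v) \<in> V"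
    by (auto simp: units_of_subring_def)
  then have "inverse a \<in> V"
    using is_subring_mult[OF V \<open>v \<in> V\<close>, of "inverse (a * v)"] by (simp add: field_simps)
  with assms \<open>a \<noteq> 0\<close> show False
    by (simp add: units_of_subring_def)
qed

text \<open>For nonzero a and b, one of a/b and b/a lies in \<open>V\<close>, so a + b is a multiple
  of the nonunit b or of the nonunit a.\<close>

lemma valuation_ring_nonunits_add:
  assumes V: "is_valuation_ring V"
    and ab: "a \<in> V - units_of_subring V" "b \<in> V - units_of_subring V"
  shows "a + b \<in> V - units_of_subring V"
proof -
  note S = is_valuation_ring_subring[OF V]
  have *: "a + b \<notin> units_of_subring V"
    if "a \<in> V" "b \<in> V - units_of_subring V" "b \<noteq> 0" "a / b \<in> V" for a b
  proof -
    have "b * (1 + a / b) \<notin> units_of_subring V"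
      using that by (intro nonunits_mult is_subring_add S is_subring_1) auto
    then show ?thesis
      using that by (simp add: distrib_left add.commute)
  qed
  have "a + b \<in> V"
    using ab by (intro is_subring_add S) auto
  moreover have "a + b \<notin> units_of_subring V"
  proof (cases "a = 0 \<or> b = 0")
    case False
    then have "a / b \<in> V \<or> b / a \<in> V"
      using V unfolding is_valuation_ring_def by (metis inverse_divide)
    then show ?thesis
      using *[of a b] *[of b a] False ab by (auto simp: add.commute)
  qed (use ab in auto)
  ultimately show ?thesis
    by blast
qed

lemma valuation_ring_nonunits_sum:
  assumes V: "is_valuation_ring V" and "\<And>i. i \<in> I \<Longrightarrow> f i \<in> V - units_of_subring V"
  shows "sum f I \<in> V - units_of_subring V"
  using assms(2)
proof (induction I rule: infinite_finite_induct)
  case (insert x F)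
  then show ?case
    using valuation_ring_nonunits_add[OF V, of "f x" "sum f F"] by simp
qed (use is_subring_0[OF is_valuation_ring_subring[OF V]] in \<open>auto simp: units_of_subring_def\<close>)

text \<open>Let a and b be the first positions of unit coefficients. In the coefficient of the
  product at a + b, every summand other than \<open>coeff p a * coeff q b\<close> has a factor at an
  earlier position, which is a nonunit.\<close>

lemma valuation_ring_prod_has_unit_coeff:
  assumes V: "is_valuation_ring V"
    and p: "p \<in> polys_over V" "coeff p i \<in> units_of_subring V"
    and q: "q \<in> polys_over V" "coeff q j \<in> units_of_subring V"
  shows "\<exists>k. coeff (p * q) k \<in> units_of_subring V"
proof -
  note S = is_valuation_ring_subring[OF V]
  let ?U = "units_of_subring V"
  define a where "a = (LEAST i. coeff p i \<in> ?U)"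
  define b where "b = (LEAST i. coeff q i \<in> ?U)"
  have a: "coeff p a \<in> ?U" "\<And>i. i < a \<Longrightarrow> coeff p i \<notin> ?U"
    unfolding a_def by (rule LeastI, rule p) (use not_less_Least in blast)
  have b: "coeff q b \<in> ?U" "\<And>i. i < b \<Longrightarrow> coeff q i \<notin> ?U"
    unfolding b_def by (rule LeastI, rule q) (use not_less_Least in blast)
  let ?f = "\<lambda>k. coeff p k * coeff q (a + b - k)"
  let ?rest = "sum ?f ({..a + b} - {a})"
  have coeff: "coeff (p * q) (a + b) = coeff p a * coeff q b + ?rest"
    by (simp add: coeff_mult sum.remove[of "{..a + b}" a])
  have in_V: "coeff p k \<in> V" "coeff q k \<in> V" for k
    using p q by (auto simp: polys_over_def)
  have rest: "?rest \<in> V - ?U"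
  proof (rule valuation_ring_nonunits_sum[OF V])
    fix k assume k: "k \<in> {..a + b} - {a}"
    have "?f k \<notin> ?U"
    proof (cases "k < a")
      case True
      then show ?thesis
        using in_V a by (intro nonunits_mult[OF S]) auto
    next
      case False
      then have "a + b - k < b"
        using k by auto
      then show ?thesis
        using in_V b nonunits_mult[OF S, of "coeff q (a + b - k)" "coeff p k"]
        by (auto simp: mult.commute)
    qed
    then show "?f k \<in> V - ?U"
      using is_subring_mult[OF S in_V] by blast
  qed
  have "coeff (p * q) (a + b) \<in> ?U"
  proof (rule ccontr)
    assume *: "coeff (p * q) (a + b) \<notin> ?U"
    have "- ?rest \<in> V - ?U"
      using rest is_subring_diff[OF S is_subring_0[OF S], of ?rest]
        is_subring_diff[OF S is_subring_0[OF S] is_subring_1[OF S]] nonunits_mult[OF S, of ?rest "- 1"]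
      by simp
    moreover have "coeff (p * q) (a + b) \<in> V"
      using is_subring_polys_over[OF S] p q
      by (metis (no_types, lifting) is_subring_mult mem_Collect_eq polys_over_def)
    ultimately have "coeff (p * q) (a + b) + - ?rest \<in> V - ?U"
      using * by (intro valuation_ring_nonunits_add V) auto
    then show False
      using units_of_subring_mult[OF S a(1) b(1)] by (simp add: coeff)
  qed
  then show ?thesis ..
qed

text \<open>Write p = c p' and q = d q' with p' and q' normalized. Then p' q' has a unit
  coefficient, so c d lies in \<open>V\<close> because p q is over \<open>V\<close>, and each
  product of coefficients is c d times elements of \<open>V\<close>.\<close>

lemma valuation_ring_coeff_products:
  assumes V: "is_valuation_ring V" and pq: "p * q \<in> polys_over V"
  shows "coeff p i * coeff q j \<in> V"
proof (cases "p = 0 \<or> q = 0")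
  case True
  then show ?thesis
    using is_subring_0[OF is_valuation_ring_subring[OF V]] by auto
next
  case False
  note S = is_valuation_ring_subring[OF V]
  obtain c p' k where p: "p = smult c p'" "p' \<in> polys_over V" "coeff p' k = 1"
    using valuation_ring_normalize_poly[OF V, of p] False by metis
  obtain d q' l where q: "q = smult d q'" "q' \<in> polys_over V" "coeff q' l = 1"
    using valuation_ring_normalize_poly[OF V, of q] False by metis
  have "1 \<in> units_of_subring V"
    by (simp add: units_of_subring_def is_subring_1 S)
  then obtain m where m: "coeff (p' * q') m \<in> units_of_subring V"
    using valuation_ring_prod_has_unit_coeff[OF V p(2) _ q(2)] p(3) q(3) by metis
  have "c * d * coeff (p' * q') m = coeff (p * q) m"
    by (simp add: p q)
  also have "\<dots> \<in> V"
    using pq by (simp add: polys_over_def)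
  finally have "c * d * coeff (p' * q') m * inverse (coeff (p' * q') m) \<in> V"
    by (rule is_subring_mult[OF S]) (use m in \<open>simp add: units_of_subring_def\<close>)
  then have "c * d \<in> V"
    using m by (simp add: units_of_subring_def mult.assoc)
  then have "c * d * (coeff p' i * coeff q' j) \<in> V"
    by (rule is_subring_mult[OF S])
      (use p q in \<open>auto simp: polys_over_def intro!: is_subring_mult[OF S]\<close>)
  then show ?thesis
    by (simp add: p q mult_ac)
qed

section \<open>Integrally closed domains\<close>

abbreviation (input) base_ring :: "'a::idom fract set" where
  "base_ring \<equiv> range to_fract"

lemma is_subring_base_ring: "is_subring base_ring"
  by (auto simp: is_subring_def simp flip: to_fract_1 to_fract_diff to_fract_mult)

lemma polys_over_base_ring: "p \<in> polys_over base_ring \<longleftrightarrow> (\<exists>p'. p = fract_poly p')"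
proof
  assume "p \<in> polys_over base_ring"
  then have p: "coeff p i \<in> base_ring" for i
    by (simp add: polys_over_def)
  have "fract_poly (map_poly (the_inv to_fract) p) = p"
  proof (rule poly_eqI)
    fix n
    have inj: "inj (to_fract :: 'a \<Rightarrow> 'a fract)"
      by (simp add: inj_def)
    \<comment> \<open>The inverse of the embedding must fix 0 for \<open>map_poly\<close> to act on
      each coefficient.\<close>
    have "the_inv to_fract (0 :: 'a fract) = 0"
      using the_inv_f_f[OF inj, of 0] by simp
    then show "coeff (fract_poly (map_poly (the_inv to_fract) p)) n = coeff p n"
      using f_the_inv_into_f[OF inj p] by (simp add: coeff_map_poly)
  qed
  then show "\<exists>p'. p = fract_poly p'"
    by metis
qed (auto simp: polys_over_def coeff_map_poly)

text \<open>If z = p(1/z), then multiplying by z to the degree of p gives a monic equation of degree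
  one larger. For z = 0 the polynomial x serves directly.\<close>

lemma integral_elem_if_in_adjoin_inverse:
  assumes "z \<in> adjoin base_ring (inverse z)"
  shows "integral_elem z"
proof (cases "z = 0")
  case True
  then show ?thesis
    by (auto simp: integral_elem_def map_poly_pCons intro!: exI[of _ "[:0, 1:]"])
next
  case False
  obtain p where p: "z = poly (fract_poly p) (inverse z)"
    using assms by (auto simp: adjoin_def polys_over_base_ring)
  define m where "m = monom 1 (Suc (degree p)) - reflect_poly p"
  have "degree (reflect_poly p) < Suc (degree p)"
    using degree_reflect_poly_le[of p] by simp
  then have deg: "degree m = Suc (degree p)"
    unfolding m_def diff_conv_add_uminus
    by (subst degree_add_eq_left) (auto simp: degree_monom_eq)
  have "lead_coeff m = 1"
    using \<open>degree (reflect_poly p) < _\<close> by (simp add: deg) (simp add: m_def coeff_eq_0)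
  moreover have "fract_poly (reflect_poly p) = reflect_poly (fract_poly p)"
    by (rule poly_eqI) (simp add: coeff_map_poly coeff_reflect_poly degree_map_poly)
  then have "poly (fract_poly m) z = 0"
    using False p[symmetric]
    by (simp add: m_def poly_monom poly_reflect_poly_nz map_poly_monom degree_map_poly)
  ultimately show ?thesis
    unfolding integral_elem_def by blast
qed

text \<open>If the product z were outside R, integral closedness would keep it out of R[1/z], so
  some valuation ring over R would omit it, against
  \<open>valuation_ring_coeff_products\<close>.\<close>

lemma integrally_closed_coeff_products:
  fixes p q :: "'a::idom fract poly"
  assumes ic: "integrally_closed TYPE('a)" and pq: "p * q \<in> polys_over base_ring"
  shows "coeff p i * coeff q j \<in> base_ring"
proof (rule ccontr)
  assume "coeff p i * coeff q j \<notin> base_ring"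
  then have "coeff p i * coeff q j \<notin> adjoin base_ring (inverse (coeff p i * coeff q j))"
    using ic integral_elem_if_in_adjoin_inverse unfolding integrally_closed_def by blast
  then obtain V where V: "is_valuation_ring V" "base_ring \<subseteq> V" "coeff p i * coeff q j \<notin> V"
    using exists_valuation_ring_avoiding[OF is_subring_base_ring] by metis
  then have "p * q \<in> polys_over V"
    using pq by (auto simp: polys_over_def)
  with V show False
    using valuation_ring_coeff_products by blast
qed

section \<open>Primitive polynomials\<close>

lemma base_ring_mult_inverse_iff:
  assumes "d \<noteq> 0"
  shows "inverse (to_fract d) * to_fract a \<in> base_ring \<longleftrightarrow> d dvd a"
proof
  assume "inverse (to_fract d) * to_fract a \<in> base_ring"
  then obtain e where "inverse (to_fract d) * to_fract a = to_fract e"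
    by blast
  then have "to_fract a = to_fract (d * e)"
    using assms by (simp add: field_simps)
  then show "d dvd a"
    unfolding to_fract_eq_iff by simp
qed (use assms in \<open>auto simp: field_simps elim!: dvdE\<close>)

lemma dvd_if_fract_poly_quotient:
  assumes "fract_poly a = fract_poly f * k" "k \<in> polys_over base_ring"
  shows "f dvd a"
proof -
  obtain k' where "k = fract_poly k'"
    using assms(2) by (auto simp: polys_over_base_ring)
  then have "fract_poly a = fract_poly (f * k')"
    using assms(1) by simp
  then show ?thesis
    unfolding fract_poly_eq_iff by simp
qed

lemma primitive_poly_dvd: "primitive_poly p \<Longrightarrow> q dvd p \<Longrightarrow> primitive_poly q"
  unfolding primitive_poly_def by (meson const_poly_dvd_iff dvd_trans)

lemma primitive_poly_nonzero: "primitive_poly p \<Longrightarrow> p \<noteq> 0"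
  by (auto simp: primitive_poly_def dest: spec[of _ 0])

lemma primitive_poly_degree_0_is_unit:
  assumes "primitive_poly p" "degree p = 0"
  shows "p dvd 1"
proof -
  obtain a where "p = [:a:]"
    using assms(2) by (rule degree_eq_zeroE)
  then show ?thesis
    using assms(1) const_poly_dvd_iff[of a p] unfolding primitive_poly_def by (simp add: is_unit_const_poly_iff)
qed

lemma degree_pos_not_unit:
  fixes p :: "'a::idom poly"
  shows "0 < degree p \<Longrightarrow> \<not> p dvd 1"
  by (auto simp: is_unit_poly_iff)

lemma irreducible_imp_primitive_poly:
  fixes f :: "'a::idom poly"
  assumes "irreducible f" "0 < degree f"
  shows "primitive_poly f"
  unfolding primitive_poly_def
proof (intro allI impI)
  fix c assume "\<forall>i. c dvd coeff f i"
  then obtain g where g: "f = [:c:] * g"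
    by (metis const_poly_dvd_iff dvdE)
  then have "[:c:] dvd 1 \<or> g dvd 1"
    using assms(1) by (rule irreducibleD[rotated])
  moreover have "\<not> g dvd 1"
    using assms(2) g by (intro degree_pos_not_unit) (auto simp: degree_smult_eq split: if_splits)
  ultimately show "c dvd 1"
    by (simp add: is_unit_const_poly_iff)
qed

text \<open>R need not be atomic, but factors of a primitive polynomial are primitive, and primitive
  nonunits have positive degree. Hence factoring into nonunits lowers the degree.\<close>

lemma primitive_poly_irreducible_factor:
  fixes h :: "'a::idom poly"
  assumes "primitive_poly h" "0 < degree h"
  obtains f where "irreducible f" "0 < degree f" "f dvd h"
proof -
  have "\<exists>f. irreducible f \<and> 0 < degree f \<and> f dvd h"
    using assms
  proof (induction "degree h" arbitrary: h rule: less_induct)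
    case less
    show ?case
    proof (cases "irreducible h")
      case False
      then obtain a b where ab: "h = a * b" "\<not> a dvd 1" "\<not> b dvd 1"
        using primitive_poly_nonzero[OF less.prems(1)] degree_pos_not_unit[OF less.prems(2)]
        unfolding irreducible_def by blast
      then have prim: "primitive_poly a" "primitive_poly b"
        using primitive_poly_dvd[OF less.prems(1)] by simp_all
      then have "0 < degree a" "0 < degree b"
        using ab primitive_poly_degree_0_is_unit by blast+
      moreover have "degree h = degree a + degree b"
        using prim[THEN primitive_poly_nonzero] by (simp add: ab degree_mult_eq)
      ultimately obtain f where "irreducible f" "0 < degree f" "f dvd a"
        using less.hyps[of a] prim by auto
      then show ?thesis
        using ab by auto
    qed (use less in auto)
  qed
  then show thesis
    using that by blast
qed

lemma fract_poly_sum: "fract_poly (sum f A) = (\<Sum>x\<in>A. fract_poly (f x))"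
  by (induction A rule: infinite_finite_induct) simp_all

lemma fract_poly_clear_denominators:
  obtains d where "d \<noteq> 0" "smult (to_fract d) p \<in> polys_over base_ring"
proof -
  have "\<exists>d. d \<noteq> 0 \<and> smult (to_fract d) p \<in> polys_over base_ring"
  proof (induction p)
    case 0
    then show ?case
      by (auto simp: polys_over_def intro!: exI[of _ 1] image_eqI[of _ _ 0])
  next
    case (pCons x p)
    then obtain d where d: "d \<noteq> 0" "\<And>i. to_fract d * coeff p i \<in> base_ring"
      by (auto simp: polys_over_def)
    obtain a b where ab: "x = to_fract a / to_fract b" "b \<noteq> 0"
      by (cases x) (auto simp: Fract_conv_to_fract)
    have "to_fract (b * d) * coeff (pCons x p) i \<in> base_ring" for i
    proof (cases i)
      case 0
      then have "to_fract (b * d) * coeff (pCons x p) i = to_fract (d * a)"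
        using ab by simp
      then show ?thesis
        by blast
    next
      case (Suc j)
      then show ?thesis
        using is_subring_mult[OF is_subring_base_ring, of "to_fract b", OF _ d(2)]
        by (simp add: mult.assoc)
    qed
    then show ?case
      using ab d by (intro exI[of _ "b * d"]) (simp add: polys_over_def del: to_fract_mult smult_pCons)
  qed
  then show thesis
    using that by blast
qed

text \<open>If the atom p divides b c but neither b nor c, then \<open>[:p, b:]\<close> and
  \<open>[:p, c:]\<close> are primitive, while p divides all coefficients p p, p (b + c), b c of
  their product.\<close>

lemma GL_domain_imp_AP_domain:
  assumes "GL_domain TYPE('a::idom)"
  shows "AP_domain TYPE('a)"
  unfolding AP_domain_def
proof (intro allI impI)
  fix p :: 'a assume p: "irreducible p"
  have prim: "primitive_poly [:p, b:]" if "\<not> p dvd b" for b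
    unfolding primitive_poly_def
  proof (intro allI impI)
    fix d assume d: "\<forall>i. d dvd coeff [:p, b:] i"
    from d[rule_format, of 0] d[rule_format, of 1] have "d dvd p" "d dvd b"
      by simp_all
    from \<open>d dvd p\<close> obtain e where e: "p = d * e"
      by auto
    \<comment> \<open>If e were a unit, p would be an associate of d and would divide b.\<close>
    moreover have "\<not> e dvd 1"
    proof
      assume "e dvd 1"
      then have "p dvd d"
        unfolding e by (metis dvd_refl mult.right_neutral mult_dvd_mono)
      with \<open>d dvd b\<close> that show False
        using dvd_trans by blast
    qed
    ultimately show "d dvd 1"
      using irreducibleD[OF p] by blast
  qed
  show "prime_elem p"
  proof (rule prime_elemI)
    fix b c assume bc: "p dvd b * c"
    show "p dvd b \<or> p dvd c"
    proof (rule ccontr)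
      assume "\<not> ?thesis"
      then have "primitive_poly ([:p, b:] * [:p, c:])"
        using assms prim unfolding GL_domain_def by blast
      moreover have "p dvd coeff ([:p, b:] * [:p, c:]) i" for i
        using bc by (auto simp: coeff_pCons mult.commute[of c] split: nat.splits)
      ultimately show False
        using p unfolding primitive_poly_def irreducible_def by blast
    qed
  qed (use p in \<open>auto simp: irreducible_def\<close>)
qed

text \<open>Clearing denominators in p q makes f divide a product u v over R. The prime f divides u
  or v, which have the degrees of p and q, so the other factor is a nonzero constant of K.\<close>

lemma AP_domain_imp_irreducible_fract_poly:
  fixes f :: "'a::idom poly"
  assumes "AP_domain TYPE('a poly)" "0 < degree f" "irreducible f"
  shows "irreducible (fract_poly f)"
proof (rule irreducibleI)
  show "fract_poly f \<noteq> 0" "\<not> fract_poly f dvd 1"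
    using assms degree_pos_not_unit[of "fract_poly f"] by (auto simp: degree_map_poly)
next
  fix p q assume pq: "fract_poly f = p * q"
  have nz: "p \<noteq> 0" "q \<noteq> 0"
    using pq assms by auto
  obtain d where d: "d \<noteq> 0" "smult (to_fract d) p \<in> polys_over base_ring"
    by (rule fract_poly_clear_denominators)
  then obtain u where u: "smult (to_fract d) p = fract_poly u"
    by (auto simp: polys_over_base_ring)
  obtain e where e: "e \<noteq> 0" "smult (to_fract e) q \<in> polys_over base_ring"
    by (rule fract_poly_clear_denominators)
  then obtain v where v: "smult (to_fract e) q = fract_poly v"
    by (auto simp: polys_over_base_ring)
  have "fract_poly (u * v) = fract_poly (smult (d * e) f)"
    by (simp add: pq mult.commute flip: u v)
  then have "f dvd u * v"
    unfolding fract_poly_eq_iff by (simp add: dvd_smult)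
  then have "f dvd u \<or> f dvd v"
    using assms prime_elem_dvd_multD unfolding AP_domain_def by blast
  moreover have "degree u = degree p" "degree v = degree q"
    using arg_cong[OF u, of degree] arg_cong[OF v, of degree] d e by (simp_all add: degree_map_poly)
  moreover have "u \<noteq> 0" "v \<noteq> 0"
    using u v d e nz by auto
  ultimately have "degree f \<le> degree p \<or> degree f \<le> degree q"
    using dvd_imp_degree_le by metis
  moreover have "degree f = degree p + degree q"
    using arg_cong[OF pq, of degree] nz by (simp add: degree_map_poly degree_mult_eq)
  ultimately have "degree p = 0 \<or> degree q = 0"
    by linarith
  then show "p dvd 1 \<or> q dvd 1"
    using nz by (metis is_unit_iff_degree)
qed

section \<open>Factorizations over the quotient field\<close>

text \<open>The property through which all implications involving (4) pass: a factorization over \<open>K\<close> of a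
  primitive polynomial becomes one over \<open>R\<close> after moving a scalar between the two factors.\<close>

definition rescalable :: "'a::idom fract poly \<Rightarrow> 'a fract poly \<Rightarrow> bool" where
  "rescalable p q \<longleftrightarrow> (\<exists>c. c \<noteq> 0 \<and> smult c p \<in> polys_over base_ring
     \<and> smult (inverse c) q \<in> polys_over base_ring)"

definition primitive_factors_rescalable :: "'a::idom itself \<Rightarrow> bool" where
  "primitive_factors_rescalable _ \<longleftrightarrow>
     (\<forall>(h :: 'a poly) p q. primitive_poly h \<longrightarrow> fract_poly h = p * q \<longrightarrow> rescalable p q)"

lemma rescalable_commute: "rescalable p q \<Longrightarrow> rescalable q p"
  unfolding rescalable_def by (metis inverse_inverse_eq nonzero_imp_inverse_nonzero)

lemma rescalable_mult_left:
  assumes "rescalable p q"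
  shows "rescalable (fract_poly f * p) q"
proof -
  obtain c where c: "c \<noteq> 0" "smult c p \<in> polys_over base_ring" "smult (inverse c) q \<in> polys_over base_ring"
    using assms unfolding rescalable_def by blast
  have "fract_poly f * smult c p \<in> polys_over base_ring"
    using is_subring_mult[OF is_subring_polys_over[OF is_subring_base_ring] _ c(2)]
    by (auto simp: polys_over_base_ring)
  then show ?thesis
    using c unfolding rescalable_def by auto
qed

lemma rescalable_const_left:
  assumes "degree p = 0" "p \<noteq> 0" "p * q = fract_poly h"
  shows "rescalable p q"
proof -
  obtain a where a: "p = [:a:]"
    using assms(1) by (rule degree_eq_zeroE)
  then have "smult (inverse a) p = fract_poly 1" "smult (inverse (inverse a)) q = fract_poly h"
    using assms(2,3) by (simp_all add: pCons_one)
  moreover have "inverse a \<noteq> 0"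
    using assms(2) a by simp
  ultimately show ?thesis
    unfolding rescalable_def polys_over_base_ring by blast
qed

text \<open>Induction on the degree: an irreducible nonconstant factor f of h stays irreducible over
  K, so it is prime there and divides p or q. Cancelling it leaves a factorization of h/f, which the
  induction rescales. If h is constant, so is p, and p can be scaled to 1.\<close>

lemma irreducible_fract_imp_rescalable:
  fixes h :: "'a::idom poly"
  assumes irr: "\<And>f :: 'a poly. 0 < degree f \<Longrightarrow> irreducible f \<Longrightarrow> irreducible (fract_poly f)"
    and "primitive_poly h" "fract_poly h = p * q"
  shows "rescalable p q"
  using assms(2,3)
proof (induction "degree h" arbitrary: h p q rule: less_induct)
  case less
  have nz: "p \<noteq> 0" "q \<noteq> 0"
    using less.prems(2) primitive_poly_nonzero[OF less.prems(1)] by auto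
  show ?case
  proof (cases "degree h = 0")
    case True
    then have "degree p = 0"
      using arg_cong[OF less.prems(2), of degree] nz by (simp add: degree_map_poly degree_mult_eq)
    then show ?thesis
      using nz by (intro rescalable_const_left[OF _ _ less.prems(2)[symmetric]])
  next
    case False
    then obtain f where f: "irreducible f" "0 < degree f" "f dvd h"
      using primitive_poly_irreducible_factor[OF less.prems(1)] by auto
    then obtain g where g: "h = f * g"
      by auto
    have "primitive_poly g" "degree g < degree h"
      using primitive_poly_dvd[OF less.prems(1), of g] primitive_poly_nonzero[OF less.prems(1)] f(2)
      by (auto simp: g degree_mult_eq)
    note IH = less.hyps[OF this(2,1)]
    have step: "rescalable r s" if rs: "fract_poly f dvd r" "r * s = fract_poly h" for r s
    proof -
      obtain t where t: "r = fract_poly f * t"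
        using rs(1) by auto
      then have "fract_poly f * (t * s) = fract_poly f * fract_poly g"
        using rs(2) by (simp add: g mult.assoc)
      then have "fract_poly g = t * s"
        using f by auto
      then show ?thesis
        unfolding t by (intro rescalable_mult_left IH)
    qed
    have "fract_poly f dvd p * q"
      using f(3) less.prems(2) by (metis fract_poly_dvd)
    then have "fract_poly f dvd p \<or> fract_poly f dvd q"
      using field_poly_irreducible_imp_prime[OF irr[OF f(2,1)]] prime_elem_dvd_multD by blast
    then show ?thesis
      using step[of p q] step[of q p] less.prems(2) rescalable_commute by (auto simp: mult.commute)
  qed
qed

lemma rescalable_imp_irreducible_fract_poly:
  fixes f :: "'a::idom poly"
  assumes "primitive_factors_rescalable TYPE('a)" "0 < degree f" "irreducible f"
  shows "irreducible (fract_poly f)"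
proof (rule irreducibleI)
  show "fract_poly f \<noteq> 0" "\<not> fract_poly f dvd 1"
    using assms degree_pos_not_unit[of "fract_poly f"] by (auto simp: degree_map_poly)
next
  fix p q assume pq: "fract_poly f = p * q"
  then obtain c where c: "c \<noteq> 0" "smult c p \<in> polys_over base_ring"
      "smult (inverse c) q \<in> polys_over base_ring"
    using assms(1) irreducible_imp_primitive_poly[OF assms(3,2)]
    unfolding primitive_factors_rescalable_def rescalable_def by blast
  obtain u v where uv: "smult c p = fract_poly u" "smult (inverse c) q = fract_poly v"
    using c by (auto simp: polys_over_base_ring)
  have "fract_poly f = smult c p * smult (inverse c) q"
    using c(1) pq by simp
  then have "fract_poly f = fract_poly (u * v)"
    by (simp only: uv fract_poly_mult)
  then have "f = u * v"
    unfolding fract_poly_eq_iff .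
  then have "u dvd 1 \<or> v dvd 1"
    using assms(3) irreducibleD by blast
  then have "smult c p dvd 1 \<or> smult (inverse c) q dvd 1"
    using fract_poly_is_unit uv by metis
  then show "p dvd 1 \<or> q dvd 1"
    using c(1) by (simp add: smult_dvd_iff)
qed

section \<open>Polynomials over a domain with the PSP-property\<close>

text \<open>For fixed z, the x with z x in R form a submodule of K, so generators suffice.\<close>

lemma ideal_inverse_span: "ideal_inverse (fract_module.span S) = {z. \<forall>s\<in>S. z * s \<in> base_ring}"
proof -
  have "z * y \<in> base_ring" if "\<forall>s\<in>S. z * s \<in> base_ring" "y \<in> fract_module.span S" for z y
    using that(2)
  proof (induction rule: fract_module.span_induct)
    case base
    show ?case
    proof (rule fract_module.subspaceI)
      fix r x assume "x \<in> {x. z * x \<in> base_ring}"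
      then have "to_fract r * (z * x) \<in> base_ring"
        by (intro is_subring_mult[OF is_subring_base_ring, of "to_fract r" "z * x"]) auto
      then show "fract_scale r x \<in> {x. z * x \<in> base_ring}"
        by (simp add: fract_scale_def mult_ac)
    qed (auto simp: distrib_left intro: is_subring_0 is_subring_add is_subring_base_ring)
  qed (use that in auto)
  then show ?thesis
    unfolding ideal_inverse_def by (auto intro: fract_module.span_base)
qed

lemma subspace_ideal_inverse: "fract_module.subspace (ideal_inverse F)"
proof (rule fract_module.subspaceI)
  fix r x assume "x \<in> ideal_inverse F"
  then have "to_fract r * (x * y) \<in> base_ring" if "y \<in> F" for y
    using that
    by (intro is_subring_mult[OF is_subring_base_ring, of "to_fract r" "x * y"]) (auto simp: ideal_inverse_def)
  then show "fract_scale r x \<in> ideal_inverse F"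
    by (simp add: fract_scale_def ideal_inverse_def mult.assoc)
qed (auto simp: ideal_inverse_def distrib_right intro: is_subring_0 is_subring_add is_subring_base_ring)

text \<open>\<open>ideal_inverse_span\<close> is applied to one factor at a time, with the other
  factor absorbed into the multiplier z.\<close>

lemma ideal_inverse_prod_spans:
  "ideal_inverse (ideal_prod (fract_module.span S) (fract_module.span T)) =
     {z. \<forall>s\<in>S. \<forall>t\<in>T. z * (s * t) \<in> base_ring}"
proof -
  have "(\<forall>b\<in>fract_module.span S. \<forall>c\<in>fract_module.span T. z * (b * c) \<in> base_ring) \<longleftrightarrow>
        (\<forall>s\<in>S. \<forall>t\<in>T. z * (s * t) \<in> base_ring)" for z
  proof -
    have "(\<forall>b\<in>fract_module.span S. \<forall>c\<in>fract_module.span T. z * (b * c) \<in> base_ring) \<longleftrightarrow>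
        (\<forall>b\<in>fract_module.span S. z * b \<in> ideal_inverse (fract_module.span T))"
      by (simp add: ideal_inverse_def mult.assoc)
    also have "\<dots> \<longleftrightarrow> (\<forall>t\<in>T. z * t \<in> ideal_inverse (fract_module.span S))"
      unfolding ideal_inverse_span[of T] unfolding ideal_inverse_def
      by (auto simp: mult.assoc) (metis mult.commute)+
    also have "\<dots> \<longleftrightarrow> (\<forall>s\<in>S. \<forall>t\<in>T. z * (s * t) \<in> base_ring)"
      unfolding ideal_inverse_span by (auto simp: mult.assoc) (metis mult.commute)+
    finally show ?thesis .
  qed
  then show ?thesis
    unfolding ideal_prod_def ideal_inverse_span by blast
qed

lemma PSP_property_iff:
  "PSP_property TYPE('a::idom) \<longleftrightarrow>
     (\<forall>(p :: 'a poly) z. primitive_poly p \<longrightarrow> smult z (fract_poly p) \<in> polys_over base_ring \<longrightarrow> z \<in> base_ring)"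
proof -
  have "(\<forall>i\<in>{..degree p}. z * to_fract (coeff p i) \<in> base_ring) \<longleftrightarrow>
        smult z (fract_poly p) \<in> polys_over base_ring" for p :: "'a poly" and z
  proof
    assume *: "\<forall>i\<in>{..degree p}. z * to_fract (coeff p i) \<in> base_ring"
    have "z * to_fract (coeff p i) \<in> base_ring" for i
      using * is_subring_0[OF is_subring_base_ring] by (cases "i \<le> degree p") (auto simp: coeff_eq_0)
    then show "smult z (fract_poly p) \<in> polys_over base_ring"
      by (simp add: polys_over_def coeff_map_poly)
  qed (simp add: polys_over_def coeff_map_poly)
  then show ?thesis
    unfolding PSP_property_def ideal_inverse_span by auto
qed

text \<open>Each coefficient of k times f is over R by
  \<open>integrally_closed_coeff_products\<close>, so PSP puts that coefficient into R.\<close>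

lemma primitive_poly_cancel:
  fixes f :: "'a::idom poly"
  assumes "integrally_closed TYPE('a)" "PSP_property TYPE('a)" "primitive_poly f"
    and fk: "fract_poly f * k \<in> polys_over base_ring"
  shows "k \<in> polys_over base_ring"
proof -
  have "smult (coeff k j) (fract_poly f) \<in> polys_over base_ring" for j
    using integrally_closed_coeff_products[OF assms(1) fk] by (simp add: polys_over_def mult.commute)
  then show ?thesis
    using assms(2,3) unfolding PSP_property_iff polys_over_def[of base_ring] by blast
qed

text \<open>If d divides all coefficients of f g, then f times g/d is over R, and cancelling f shows
  that d divides the coefficients of the primitive g.\<close>

lemma PSP_property_imp_GL_domain:
  assumes "integrally_closed TYPE('a::idom)" "PSP_property TYPE('a)"
  shows "GL_domain TYPE('a)"
  unfolding GL_domain_def primitive_poly_def[of "_ * _"]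
proof (intro allI impI)
  fix f g :: "'a poly" and d
  assume fg: "primitive_poly f" "primitive_poly g" and d: "\<forall>i. d dvd coeff (f * g) i"
  have "f * g \<noteq> 0"
    using fg primitive_poly_nonzero by auto
  then have "d \<noteq> 0"
    using d by (auto simp: poly_eq_iff)
  have "fract_poly f * smult (inverse (to_fract d)) (fract_poly g) =
      smult (inverse (to_fract d)) (fract_poly (f * g))"
    by simp
  also have "\<dots> \<in> polys_over base_ring"
    using d base_ring_mult_inverse_iff[OF \<open>d \<noteq> 0\<close>]
    by (simp add: polys_over_def coeff_map_poly del: fract_poly_mult)
  finally have "smult (inverse (to_fract d)) (fract_poly g) \<in> polys_over base_ring"
    by (rule primitive_poly_cancel[OF assms fg(1)])
  then have "d dvd coeff g i" for i
    using base_ring_mult_inverse_iff[OF \<open>d \<noteq> 0\<close>] by (simp add: polys_over_def coeff_map_poly)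
  then show "d dvd 1"
    using fg(2) by (simp add: primitive_poly_def)
qed

text \<open>Rescaling the factorization (x^m + z) f by c puts c and c z into R and makes c divide
  all coefficients of f. So c is a unit, and z is c z divided by c.\<close>

lemma rescalable_imp_PSP_property:
  assumes "primitive_factors_rescalable TYPE('a::idom)"
  shows "PSP_property TYPE('a)"
  unfolding PSP_property_iff
proof (intro allI impI)
  fix f :: "'a poly" and z
  assume f: "primitive_poly f" and "smult z (fract_poly f) \<in> polys_over base_ring"
  then obtain g where g: "smult z (fract_poly f) = fract_poly g"
    by (auto simp: polys_over_base_ring)
  \<comment> \<open>\<open>m\<close> is so large that the coefficients of \<open>f\<close> reappear in \<open>h\<close>, which is therefore primitive.\<close>
  define m where "m = Suc (degree f)"
  define h where "h = monom 1 m * f + g"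
  have "fract_poly h = (monom 1 m + [:z:]) * fract_poly f"
    by (simp add: h_def map_poly_monom distrib_right flip: g)
  moreover have "primitive_poly h"
    unfolding primitive_poly_def
  proof (intro allI impI)
    fix d assume d: "\<forall>i. d dvd coeff h i"
    have "degree g < m"
      using arg_cong[OF g, of degree] by (auto simp: degree_map_poly m_def split: if_splits)
    then have "coeff h (i + m) = coeff f i" for i
      by (simp add: h_def coeff_monom_mult coeff_eq_0)
    then show "d dvd 1"
      using f d unfolding primitive_poly_def by metis
  qed
  ultimately obtain c where c: "c \<noteq> 0" "smult c (monom 1 m + [:z:]) \<in> polys_over base_ring"
      "smult (inverse c) (fract_poly f) \<in> polys_over base_ring"
    using assms unfolding primitive_factors_rescalable_def rescalable_def by blast
  have cz: "c * coeff (monom 1 m + [:z:]) i \<in> base_ring" for i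
    using c(2) by (simp add: polys_over_def)
  have "c \<in> base_ring" "c * z \<in> base_ring"
    using cz[of m] cz[of 0] by (simp_all add: m_def)
  then obtain c' where c': "c = to_fract c'"
    by blast
  then have "c' \<noteq> 0"
    using c(1) by auto
  have "c' dvd coeff f i" for i
    using c(3) base_ring_mult_inverse_iff[OF \<open>c' \<noteq> 0\<close>] by (simp add: c' polys_over_def coeff_map_poly)
  then have "c' dvd 1"
    using f by (simp add: primitive_poly_def)
  then have "inverse c \<in> base_ring"
    using base_ring_mult_inverse_iff[OF \<open>c' \<noteq> 0\<close>, of 1] by (simp add: c')
  then have "inverse c * (c * z) \<in> base_ring"
    using \<open>c * z \<in> base_ring\<close> is_subring_mult[OF is_subring_base_ring] by blast
  then show "z \<in> base_ring"
    using c(1) by (simp flip: mult.assoc)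
qed

text \<open>A root z of a monic p gives p = (x - z) q with q monic. After rescaling by c, the
  leading coefficient of q puts 1/c into R, and the constant term of x - z puts c z there.\<close>

lemma rescalable_imp_integrally_closed:
  assumes "primitive_factors_rescalable TYPE('a::idom)"
  shows "integrally_closed TYPE('a)"
  unfolding integrally_closed_def integral_elem_def
proof (intro allI impI)
  fix z :: "'a fract"
  assume "\<exists>p. lead_coeff p = 1 \<and> poly (fract_poly p) z = 0"
  then obtain p where p: "lead_coeff p = 1" "poly (fract_poly p) z = 0"
    by blast
  then obtain q where q: "fract_poly p = [:- z, 1:] * q"
    by (auto simp: poly_eq_0_iff_dvd)
  have "primitive_poly p"
    unfolding primitive_poly_def using p(1) by metis
  then obtain c where c: "c \<noteq> 0" "smult c [:- z, 1:] \<in> polys_over base_ring"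
      "smult (inverse c) q \<in> polys_over base_ring"
    using assms q unfolding primitive_factors_rescalable_def rescalable_def by blast
  have cz: "c * coeff [:- z, 1:] i \<in> base_ring" "inverse c * coeff q i \<in> base_ring" for i
    using c(2,3) unfolding polys_over_def by (auto simp only: coeff_smult mem_Collect_eq)
  have "lead_coeff (fract_poly p) = lead_coeff q"
    unfolding q by (simp only: lead_coeff_mult) simp
  then have "lead_coeff q = 1"
    using p(1) by (simp add: degree_map_poly coeff_map_poly)
  then have "inverse c \<in> base_ring" "c * (- z) \<in> base_ring"
    using cz(1)[of 0] cz(2)[of "degree q"] by simp_all
  then have "0 - inverse c * (c * (- z)) \<in> base_ring"
    by (intro is_subring_diff is_subring_mult[of _ "inverse c" "c * (- z)"] is_subring_0
        is_subring_base_ring)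
  then show "z \<in> base_ring"
    using c(1) by (simp flip: mult.assoc)
qed

section \<open>The GL-property of the polynomial ring\<close>

text \<open>Kronecker substitution: when N exceeds the degrees of all coefficients of F, their
  shifted copies occupy disjoint blocks of exponents.\<close>

lemma coeff_poly_monom:
  fixes F :: "'a::comm_semiring_1 poly poly"
  assumes "\<And>j. degree (coeff F j) < N" "i < N"
  shows "coeff (poly F (monom 1 N)) (i + N * j) = coeff (coeff F j) i"
  using assms(1)
proof (induction F arbitrary: j)
  case (pCons a F)
  have F: "degree (coeff F j) < N" for j
    using pCons.prems[of "Suc j"] by simp
  have "degree a < N"
    using pCons.prems[of 0] by simp
  then show ?case
    using pCons.IH[OF F] \<open>i < N\<close> by (cases j) (auto simp: coeff_monom_mult coeff_eq_0 add.assoc)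
qed simp

lemma primitive_poly_poly_monom:
  fixes F :: "'a::idom poly poly"
  assumes "\<And>j. degree (coeff F j) < N" "primitive_poly F"
  shows "primitive_poly (poly F (monom 1 N))"
  unfolding primitive_poly_def
proof (intro allI impI)
  fix d assume d: "\<forall>i. d dvd coeff (poly F (monom 1 N)) i"
  have "d dvd coeff (coeff F j) i" for i j
  proof (cases "i < N")
    case True
    then show ?thesis
      using coeff_poly_monom[OF assms(1), of i j] d by metis
  next
    case False
    then show ?thesis
      using assms(1)[of j] by (simp add: coeff_eq_0)
  qed
  then have "[:d:] dvd coeff F j" for j
    by (simp add: const_poly_dvd_iff)
  then have "[:d:] dvd 1"
    using assms(2) by (simp add: primitive_poly_def)
  then show "d dvd 1"
    by (simp add: is_unit_const_poly_iff)
qed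

lemma dvd_poly_if_dvd_coeffs:
  fixes P :: "'a::comm_semiring_1 poly"
  assumes "\<And>i. c dvd coeff P i"
  shows "c dvd poly P x"
  unfolding poly_altdef by (intro dvd_sum dvd_mult2 assms)

lemma exists_degree_bound: "\<exists>N. \<forall>j. degree (coeff F j) < N"
proof -
  have "degree (coeff F j) < Suc (Max ((\<lambda>j. degree (coeff F j)) ` {..degree F}))" for j
  proof (cases "j \<le> degree F")
    case True
    then show ?thesis
      by (simp add: less_Suc_eq_le)
  qed (simp add: coeff_eq_0)
  then show ?thesis
    by blast
qed

text \<open>For large N, the values of F and G at x^N are primitive over R, and so is their product
  by the GL-property. A constant that divides h divides this product.\<close>

lemma primitive_poly_prod_common_divisor:
  fixes F G :: "'a::idom poly poly"
  assumes "GL_domain TYPE('a)" "primitive_poly F" "primitive_poly G"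
    and h: "\<And>i. h dvd coeff (F * G) i"
  shows "primitive_poly h"
  unfolding primitive_poly_def
proof (intro allI impI)
  fix d assume d: "\<forall>i. d dvd coeff h i"
  obtain N1 N2 where N12: "\<And>j. degree (coeff F j) < N1" "\<And>j. degree (coeff G j) < N2"
    using exists_degree_bound by metis
  define N where "N = max N1 N2"
  have N: "degree (coeff F j) < N" "degree (coeff G j) < N" for j
    using N12[of j] by (simp_all add: N_def less_max_iff_disj)
  have "primitive_poly (poly F (monom 1 N) * poly G (monom 1 N))"
    using assms(1) primitive_poly_poly_monom[OF N(1) assms(2)] primitive_poly_poly_monom[OF N(2) assms(3)]
    unfolding GL_domain_def by blast
  moreover have "[:d:] dvd h"
    using d by (simp add: const_poly_dvd_iff)
  then have "[:d:] dvd coeff (F * G) i" for i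
    using h dvd_trans by blast
  then have "[:d:] dvd poly (F * G) (monom 1 N)"
    by (rule dvd_poly_if_dvd_coeffs)
  then have "[:d:] dvd poly F (monom 1 N) * poly G (monom 1 N)"
    by simp
  ultimately have "primitive_poly [:d:]"
    using primitive_poly_dvd by blast
  then have "[:d:] dvd 1"
    by (intro primitive_poly_degree_0_is_unit) simp_all
  then show "d dvd 1"
    by (simp add: is_unit_const_poly_iff)
qed

text \<open>A prime of K[x] stays prime as a constant of K[x][y], where divisibility by it is read
  off the coefficients.\<close>

lemma prime_fract_poly_dvd_coeffs:
  fixes F G :: "'a::idom poly poly"
  assumes "prime_elem (fract_poly f)" "\<And>i. f dvd coeff (F * G) i"
  shows "(\<forall>i. fract_poly f dvd fract_poly (coeff F i)) \<or> (\<forall>i. fract_poly f dvd fract_poly (coeff G i))"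
proof -
  let ?m = "map_poly (map_poly to_fract)"
  have coeff_m: "coeff (?m P) i = fract_poly (coeff P i)" for P :: "'a poly poly" and i
    by (simp add: coeff_map_poly)
  have "coeff (?m F * ?m G) i = fract_poly (coeff (F * G) i)" for i
    by (simp add: coeff_mult coeff_m fract_poly_sum)
  then have "[:fract_poly f:] dvd ?m F * ?m G"
    using assms(2) by (simp add: const_poly_dvd_iff fract_poly_dvd del: fract_poly_sum)
  then have "[:fract_poly f:] dvd ?m F \<or> [:fract_poly f:] dvd ?m G"
    using lift_prime_elem_poly[OF assms(1)] prime_elem_dvd_multD by blast
  then show ?thesis
    by (simp add: const_poly_dvd_iff coeff_m)
qed

lemma rescalable_imp_GL_domain_poly:
  assumes L: "primitive_factors_rescalable TYPE('a::idom)"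
  shows "GL_domain TYPE('a poly)"
  unfolding GL_domain_def primitive_poly_def[of "_ * _"]
proof (intro allI impI)
  note PSP = rescalable_imp_PSP_property[OF L] and ic = rescalable_imp_integrally_closed[OF L]
  fix F G :: "'a poly poly" and h
  assume F: "primitive_poly F" and G: "primitive_poly G" and h: "\<forall>i. h dvd coeff (F * G) i"
  have prim: "primitive_poly h"
    using primitive_poly_prod_common_divisor[OF PSP_property_imp_GL_domain[OF ic PSP] F G] h by blast
  show "h dvd 1"
  proof (rule ccontr)
    assume "\<not> h dvd 1"
    then have "0 < degree h"
      using prim primitive_poly_degree_0_is_unit by blast
    then obtain f where f: "irreducible f" "0 < degree f" "f dvd h"
      using primitive_poly_irreducible_factor[OF prim] by blast
    \<comment> \<open>Divisibility by f descends from K to R, because cancelling the primitive f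
      leaves a quotient over R.\<close>
    have cancel: "f dvd a" if dvd: "fract_poly f dvd fract_poly a" for a
    proof -
      obtain k where k: "fract_poly a = fract_poly f * k"
        using dvd by (elim dvdE)
      moreover have "fract_poly f * k \<in> polys_over base_ring"
        unfolding k[symmetric] polys_over_base_ring by blast
      then have "k \<in> polys_over base_ring"
        by (rule primitive_poly_cancel[OF ic PSP irreducible_imp_primitive_poly[OF f(1,2)]])
      ultimately show ?thesis
        by (rule dvd_if_fract_poly_quotient)
    qed
    have "prime_elem (fract_poly f)"
      using rescalable_imp_irreducible_fract_poly[OF L f(2,1)] by (rule field_poly_irreducible_imp_prime)
    moreover have "f dvd coeff (F * G) i" for i
      using f(3) h dvd_trans by blast
    ultimately have "(\<forall>i. f dvd coeff F i) \<or> (\<forall>i. f dvd coeff G i)"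
      using prime_fract_poly_dvd_coeffs cancel by blast
    then have "f dvd 1"
      using F G by (auto simp: primitive_poly_def)
    then show False
      using f by (simp add: irreducible_def)
  qed
qed

section \<open>Divisorial ideals\<close>

lemma poly_with_coeffs:
  assumes "finite S"
  obtains p where "\<And>i. coeff p i \<in> insert 0 S" "\<And>s. s \<in> S \<Longrightarrow> \<exists>i. coeff p i = s"
proof -
  obtain xs where xs: "set xs = S"
    using finite_list[OF assms] by blast
  show thesis
  proof (rule that[of "Poly xs"])
    show "coeff (Poly xs) i \<in> insert 0 S" for i
      using xs by (auto simp: nth_default_def)
    show "\<exists>i. coeff (Poly xs) i = s" if s: "s \<in> S" for s
    proof -
      obtain i where "i < length xs" "xs ! i = s"
        using s xs by (metis in_set_conv_nth)
      then have "coeff (Poly xs) i = s"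
        by (simp add: nth_default_def)
      then show ?thesis ..
    qed
  qed
qed

text \<open>The coefficients of p q are only sums of products, so it is not clear that p q is
  primitive. With N above the degree of p, the coefficients of p(x) q(x^N) are the single products;
  \<open>inv\<close> makes it primitive, and a scalar that rescales p and q(x^N) also rescales p and
  q.\<close>

lemma rescalable_with_factor_coeffs:
  fixes p q :: "'a::idom fract poly"
  assumes L: "primitive_factors_rescalable TYPE('a)"
    and nz: "p \<noteq> 0" "q \<noteq> 0"
    and inv: "\<And>z. (\<forall>i j. z * (coeff p i * coeff q j) \<in> base_ring) \<longleftrightarrow> z \<in> base_ring"
  shows "rescalable p q"
proof -
  define N where "N = Suc (degree p)"
  define Q where "Q = pcompose q (monom 1 N)"
  \<comment> \<open>In a second variable, \<open>F\<close> has the coefficients q_j p, so its value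
    at x^N is p(x) q(x^N).\<close>
  define F where "F = map_poly (\<lambda>c. smult c p) q"
  have coeff_F: "coeff F j = smult (coeff q j) p" for j
    by (simp add: F_def coeff_map_poly)
  have comp: "poly (map_poly (\<lambda>c. smult c r) q) x = r * pcompose q x" for r x :: "'a fract poly"
  proof (induction q)
    case (pCons a q)
    then show ?case
      by (simp add: map_poly_pCons pcompose_pCons algebra_simps)
  qed simp
  have pQ: "p * Q = poly F (monom 1 N)"
    by (simp add: Q_def F_def comp)
  have coeff_pQ: "coeff (p * Q) (i + N * j) = coeff p i * coeff q j" if "i < N" for i j
    unfolding pQ using that
    by (subst coeff_poly_monom) (auto simp: coeff_F N_def less_Suc_eq_le degree_smult_le mult.commute)
  have prods: "coeff p i * coeff q j \<in> base_ring" for i j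
    using inv[of 1] is_subring_1[OF is_subring_base_ring] unfolding mult_1_left by blast
  have "p * Q \<in> polys_over base_ring"
    unfolding polys_over_def
  proof (intro CollectI allI)
    fix k
    have "k mod N < N"
      by (simp add: N_def)
    from coeff_pQ[OF this, of "k div N"] show "coeff (p * Q) k \<in> base_ring"
      using prods by simp
  qed
  then obtain h where h: "fract_poly h = p * Q"
    by (auto simp: polys_over_base_ring)
  have "primitive_poly h"
    unfolding primitive_poly_def
  proof (intro allI impI)
    fix d assume d: "\<forall>i. d dvd coeff h i"
    have prod_coeff: "\<exists>k. coeff p i * coeff q j = to_fract (coeff h k)" if "i < N" for i j
      using coeff_pQ[OF that, of j] by (metis coeff_map_poly h to_fract_0)
    have "d \<noteq> 0"
    proof
      assume "d = 0"
      then have "h = 0"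
        using d by (simp add: poly_eq_iff)
      then have "lead_coeff p * lead_coeff q = 0"
        using prod_coeff[of "degree p" "degree q"] by (auto simp: N_def)
      with nz show False
        by simp
    qed
    have "inverse (to_fract d) * (coeff p i * coeff q j) \<in> base_ring" for i j
    proof (cases "i < N")
      case True
      then show ?thesis
        using prod_coeff[of i j] d base_ring_mult_inverse_iff[OF \<open>d \<noteq> 0\<close>] by auto
    next
      case False
      then show ?thesis
        by (simp add: coeff_eq_0 N_def is_subring_0[OF is_subring_base_ring])
    qed
    then have "inverse (to_fract d) \<in> base_ring"
      using inv by blast
    then show "d dvd 1"
      using base_ring_mult_inverse_iff[OF \<open>d \<noteq> 0\<close>, of 1] by simp
  qed
  then obtain c where c: "c \<noteq> 0" "smult c p \<in> polys_over base_ring"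
      "smult (inverse c) Q \<in> polys_over base_ring"
    using L h unfolding primitive_factors_rescalable_def rescalable_def by blast
  have coeff_Q: "coeff Q (0 + N * j) = coeff q j" for j
  proof -
    have "Q = poly (map_poly (\<lambda>c. smult c 1) q) (monom 1 N)"
      using comp[of 1 "monom 1 N"] by (simp add: Q_def)
    then show ?thesis
      using coeff_poly_monom[of "map_poly (\<lambda>c. smult c 1) q" N 0 j] by (simp add: N_def coeff_map_poly)
  qed
  have "inverse c * coeff Q k \<in> base_ring" for k
    using c(3) by (simp add: polys_over_def)
  from this[of "0 + N * _", unfolded coeff_Q] have "smult (inverse c) q \<in> polys_over base_ring"
    by (simp add: polys_over_def)
  with c show ?thesis
    unfolding rescalable_def by blast
qed

text \<open>The generator is 1/c. As c lies in the inverse of B, the closure lies in the multiples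
  of 1/c. Conversely, if z is in the inverse of B, the products of z p_i and q_j/c are in R, so
  \<open>inv\<close> puts z/c into R.\<close>

lemma principal_v_closure_if_rescalable:
  fixes p q :: "'a::idom fract poly"
  assumes B: "\<And>z. z \<in> ideal_inverse B \<longleftrightarrow> (\<forall>i. z * coeff p i \<in> base_ring)"
    and inv: "\<And>z. (\<And>i j. z * (coeff p i * coeff q j) \<in> base_ring) \<Longrightarrow> z \<in> base_ring"
    and "rescalable p q"
  shows "principal_fractional_ideal (v_closure B)"
proof -
  obtain c where c: "c \<noteq> 0" "\<And>i. c * coeff p i \<in> base_ring" "\<And>j. inverse c * coeff q j \<in> base_ring"
    using assms(3) by (auto simp: rescalable_def polys_over_def)
  have "inverse c \<in> v_closure B"
    unfolding v_closure_def ideal_inverse_def[of "ideal_inverse B"]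
  proof (intro CollectI ballI)
    fix z assume "z \<in> ideal_inverse B"
    then have "(z * coeff p i) * (inverse c * coeff q j) \<in> base_ring" for i j
      using c(3) B
      by (intro is_subring_mult[of _ "z * coeff p i" "inverse c * coeff q j"] is_subring_base_ring) auto
    then have "inverse c * z * (coeff p i * coeff q j) \<in> base_ring" for i j
      by (simp add: mult_ac)
    then show "inverse c * z \<in> base_ring"
      by (rule inv)
  qed
  then have "fract_module.span {inverse c} \<subseteq> v_closure B"
    unfolding v_closure_def by (intro fract_module.span_minimal subspace_ideal_inverse) simp
  moreover have "x \<in> fract_module.span {inverse c}" if "x \<in> v_closure B" for x
  proof -
    have "c \<in> ideal_inverse B"
      using c(2) B by simp
    then have "x * c \<in> base_ring"
      using that by (simp add: v_closure_def ideal_inverse_def)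
    then obtain r where "x * c = to_fract r"
      by blast
    then have "x = fract_scale r (inverse c)"
      using c(1) by (simp add: fract_scale_def field_simps)
    then show ?thesis
      by (simp add: fract_module.span_scale fract_module.span_base)
  qed
  ultimately show ?thesis
    unfolding principal_fractional_ideal_def by blast
qed

text \<open>Take p and q whose coefficients generate B and C. The hypothesis on BC forces its
  inverse to be R, which is what \<open>rescalable_with_factor_coeffs\<close> asks of the
  coefficient products.\<close>

lemma rescalable_imp_v_invertible_principal:
  fixes B C :: "'a::idom fract set"
  assumes L: "primitive_factors_rescalable TYPE('a)"
    and B: "fin_gen_fractional_ideal B" "B \<noteq> {0}"
    and C: "fin_gen_fractional_ideal C" "C \<noteq> {0}"
    and BC: "v_closure (ideal_prod B C) = base_ring"
  shows "principal_fractional_ideal (v_closure B)"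
proof -
  have ex: "\<exists>p S. A = fract_module.span S \<and> p \<noteq> 0 \<and>
      (\<forall>i. coeff p i \<in> insert 0 S) \<and> (\<forall>s\<in>S. \<exists>i. coeff p i = s)"
    if "fin_gen_fractional_ideal A" "A \<noteq> {0}" for A :: "'a fract set"
  proof -
    obtain S where S: "finite S" "A = fract_module.span S"
      using \<open>fin_gen_fractional_ideal A\<close> by (auto simp: fin_gen_fractional_ideal_def)
    obtain p where p: "\<And>i. coeff p i \<in> insert 0 S" "\<And>s. s \<in> S \<Longrightarrow> \<exists>i. coeff p i = s"
      using poly_with_coeffs[OF S(1)] by metis
    have "p \<noteq> 0"
    proof
      assume "p = 0"
      then have "S \<subseteq> {0}"
        using p(2) by auto
      then have "A \<subseteq> {0}"
        unfolding S(2) by (intro fract_module.span_minimal fract_module.subspace_single_0)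
      then show False
        using \<open>A \<noteq> {0}\<close> S(2) fract_module.span_zero[of S] by auto
    qed
    with S p show ?thesis
      by blast
  qed
  obtain p S where p: "B = fract_module.span S" "p \<noteq> 0"
    "\<And>i. coeff p i \<in> insert 0 S" "\<And>s. s \<in> S \<Longrightarrow> \<exists>i. coeff p i = s"
    using ex[OF B] by blast
  obtain q T where q: "C = fract_module.span T" "q \<noteq> 0"
    "\<And>i. coeff q i \<in> insert 0 T" "\<And>s. s \<in> T \<Longrightarrow> \<exists>i. coeff q i = s"
    using ex[OF C] by blast
  have 0: "0 \<in> base_ring"
    by (rule is_subring_0[OF is_subring_base_ring])
  have inv_B: "z \<in> ideal_inverse B \<longleftrightarrow> (\<forall>i. z * coeff p i \<in> base_ring)" for z
  proof
    assume z: "z \<in> ideal_inverse B"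
    show "\<forall>i. z * coeff p i \<in> base_ring"
    proof
      fix i
      show "z * coeff p i \<in> base_ring"
        using z p(3)[of i] 0 unfolding p(1) ideal_inverse_span by auto
    qed
  next
    assume "\<forall>i. z * coeff p i \<in> base_ring"
    then show "z \<in> ideal_inverse B"
      unfolding p(1) ideal_inverse_span using p(4) by blast
  qed
  have inv_BC: "z \<in> ideal_inverse (ideal_prod B C) \<longleftrightarrow> (\<forall>i j. z * (coeff p i * coeff q j) \<in> base_ring)" for z
  proof
    assume z: "z \<in> ideal_inverse (ideal_prod B C)"
    show "\<forall>i j. z * (coeff p i * coeff q j) \<in> base_ring"
    proof (intro allI)
      fix i j
      show "z * (coeff p i * coeff q j) \<in> base_ring"
        using z p(3)[of i] q(3)[of j] 0 unfolding p(1) q(1) ideal_inverse_prod_spans by auto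
    qed
  next
    assume "\<forall>i j. z * (coeff p i * coeff q j) \<in> base_ring"
    then show "z \<in> ideal_inverse (ideal_prod B C)"
      unfolding p(1) q(1) ideal_inverse_prod_spans using p(4) q(4) by blast
  qed
  \<comment> \<open>That 1 lies in the closure of BC says that the inverse of BC is contained in
    R.\<close>
  have "1 \<in> ideal_inverse (ideal_inverse (ideal_prod B C))"
    using BC is_subring_1[OF is_subring_base_ring] by (simp add: v_closure_def)
  then have inv: "z \<in> base_ring" if "\<And>i j. z * (coeff p i * coeff q j) \<in> base_ring" for z
    using that inv_BC[of z] by (simp add: ideal_inverse_def)
  have "coeff p i * coeff q j \<in> base_ring" for i j
  proof -
    have "1 \<in> ideal_inverse (ideal_prod B C)"
    proof -
      have "y \<in> v_closure (ideal_prod B C)" if "y \<in> ideal_prod B C" for y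
        using that by (auto simp: v_closure_def ideal_inverse_def mult.commute)
      then show ?thesis
        unfolding BC ideal_inverse_def[of "ideal_prod B C"] by simp
    qed
    then show ?thesis
      using inv_BC[of 1] by simp
  qed
  then have "z * (coeff p i * coeff q j) \<in> base_ring" if "z \<in> base_ring" for z i j
    using that by (intro is_subring_mult[of _ z] is_subring_base_ring)
  with inv have "rescalable p q"
    by (intro rescalable_with_factor_coeffs[OF L p(2) q(2)]) blast
  then show ?thesis
    using principal_v_closure_if_rescalable[OF inv_B inv] by blast
qed

lemma fin_gen_fractional_ideal_span_coeffs:
  assumes "d \<noteq> 0" "d \<in> base_ring" "\<And>i. d * coeff p i \<in> base_ring"
  shows "fin_gen_fractional_ideal (fract_module.span (range (coeff p)))"
proof -
  obtain e where e: "d = to_fract e" "e \<noteq> 0"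
    using assms(1,2) by auto
  have "range (coeff p) \<subseteq> insert 0 (coeff p ` {..degree p})"
    by (auto simp: image_iff) (metis atMost_iff coeff_eq_0 not_le)
  then have "finite (range (coeff p))"
    by (rule finite_subset) simp
  moreover have "d \<in> ideal_inverse (fract_module.span (range (coeff p)))"
    using assms(3) by (auto simp: ideal_inverse_span)
  then have "\<forall>x\<in>fract_module.span (range (coeff p)). fract_scale e x \<in> base_ring"
    by (simp add: ideal_inverse_def fract_scale_def e)
  ultimately show ?thesis
    using e(2) unfolding fin_gen_fractional_ideal_def fractional_ideal_def by auto
qed

lemma ideal_inverse_base_ring: "ideal_inverse base_ring = base_ring"
proof (intro equalityI subsetI)
  fix z :: "'a fract" assume "z \<in> ideal_inverse base_ring"
  then have "z * 1 \<in> base_ring"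
    unfolding ideal_inverse_def using is_subring_1[OF is_subring_base_ring] by blast
  then show "z \<in> base_ring"
    by simp
qed (auto simp: ideal_inverse_def simp flip: to_fract_mult)

text \<open>For the content ideals B and C of p and q, integral closedness puts BC into R. If z is
  in the inverse of BC, then z h is over R, so z is in R by PSP. Hence the closure of BC is R, and
  the inverse of a generator of \<open>v_closure B\<close> is the scalar.\<close>

lemma v_invertible_principal_imp_rescalable:
  assumes PSP: "PSP_property TYPE('a::idom)" and ic: "integrally_closed TYPE('a)"
    and principal: "\<And>B C :: 'a fract set. fin_gen_fractional_ideal B \<Longrightarrow> B \<noteq> {0} \<Longrightarrow>
      fin_gen_fractional_ideal C \<Longrightarrow> C \<noteq> {0} \<Longrightarrow> v_closure (ideal_prod B C) = base_ring \<Longrightarrow>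
      principal_fractional_ideal (v_closure B)"
  shows "primitive_factors_rescalable TYPE('a)"
  unfolding primitive_factors_rescalable_def
proof (intro allI impI)
  fix h :: "'a poly" and p q
  assume h: "primitive_poly h" and pq: "fract_poly h = p * q"
  have nz: "p \<noteq> 0" "q \<noteq> 0"
    using pq primitive_poly_nonzero[OF h] by auto
  have "p * q \<in> polys_over base_ring"
    unfolding pq[symmetric] polys_over_base_ring by blast
  then have prods: "coeff p i * coeff q j \<in> base_ring" for i j
    by (rule integrally_closed_coeff_products[OF ic])
  \<comment> \<open>The numerator of the leading coefficient of s is a common denominator for the
    coefficients of r.\<close>
  have fin_gen: "fin_gen_fractional_ideal (fract_module.span (range (coeff r)))"
    if "s \<noteq> 0" "\<And>i j. coeff s j * coeff r i \<in> base_ring" for r s :: "'a fract poly"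
  proof -
    obtain a b where ab: "lead_coeff s = to_fract a / to_fract b" "b \<noteq> 0"
      by (cases "lead_coeff s") (auto simp: Fract_conv_to_fract)
    have "to_fract a \<noteq> 0"
      using ab that(1) by (metis divide_eq_0_iff leading_coeff_0_iff)
    moreover have "to_fract a * coeff r i \<in> base_ring" for i
    proof -
      have "to_fract a * coeff r i = to_fract b * (lead_coeff s * coeff r i)"
        unfolding ab(1) using ab(2) by simp
      also have "\<dots> \<in> base_ring"
        using that(2) by (intro is_subring_mult[of _ "to_fract b"] is_subring_base_ring) auto
      finally show ?thesis .
    qed
    ultimately show ?thesis
      using fin_gen_fractional_ideal_span_coeffs[of "to_fract a" r] by blast
  qed
  have nz_span: "fract_module.span (range (coeff r)) \<noteq> {0}" if "r \<noteq> 0" for r :: "'a fract poly"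
    using that fract_module.span_base[of "lead_coeff r" "range (coeff r)"] by auto
  define B where "B = fract_module.span (range (coeff p))"
  define C where "C = fract_module.span (range (coeff q))"
  have "ideal_inverse (ideal_prod B C) = base_ring"
  proof (intro equalityI subsetI)
    fix z assume "z \<in> ideal_inverse (ideal_prod B C)"
    then have "z * (coeff p i * coeff q j) \<in> base_ring" for i j
      unfolding B_def C_def ideal_inverse_prod_spans by blast
    then have "smult z (fract_poly h) \<in> polys_over base_ring"
      by (auto simp: pq polys_over_def coeff_mult sum_distrib_left
          intro!: is_subring_sum[OF is_subring_base_ring])
    with PSP h show "z \<in> base_ring"
      unfolding PSP_property_iff by blast
  next
    fix z :: "'a fract" assume "z \<in> base_ring"
    then show "z \<in> ideal_inverse (ideal_prod B C)"
      unfolding B_def C_def ideal_inverse_prod_spans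
      using prods is_subring_mult[OF is_subring_base_ring, of z] by blast
  qed
  moreover have "ideal_inverse base_ring = (base_ring :: 'a fract set)"
    by (rule ideal_inverse_base_ring)
  ultimately have "v_closure (ideal_prod B C) = base_ring"
    by (simp add: v_closure_def)
  moreover have "fin_gen_fractional_ideal B" "fin_gen_fractional_ideal C"
    unfolding B_def C_def
    using fin_gen[of q p] fin_gen[of p q] nz prods by (simp_all add: mult.commute)
  moreover have "B \<noteq> {0}" "C \<noteq> {0}"
    unfolding B_def C_def using nz by (simp_all only: nz_span not_False_eq_True)
  ultimately have "principal_fractional_ideal (v_closure B)"
    by (intro principal[of B C])
  then obtain x where x: "v_closure B = fract_module.span {x}"
    by (auto simp: principal_fractional_ideal_def)
  have B_inv: "z \<in> ideal_inverse B \<longleftrightarrow> (\<forall>i. z * coeff p i \<in> base_ring)" for z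
    by (auto simp: B_def ideal_inverse_span)
  have "\<exists>r. coeff p i = to_fract r * x" for i
  proof -
    have "coeff p i \<in> v_closure B"
      using B_inv by (simp add: v_closure_def ideal_inverse_def[of "ideal_inverse B"] mult.commute)
    then show ?thesis
      unfolding x fract_module.span_singleton by (auto simp: fract_scale_def)
  qed
  then obtain r where r: "\<And>i. coeff p i = to_fract (r i) * x"
    by metis
  have "x \<noteq> 0"
    using nz(1) r by (auto simp: poly_eq_iff)
  have "smult (inverse x) p \<in> polys_over base_ring"
    using \<open>x \<noteq> 0\<close> by (simp add: polys_over_def r mult.left_commute[of "inverse x"])
  \<comment> \<open>The generator x lies in \<open>v_closure B\<close>, and \<open>coeff q j\<close>
    lies in the inverse of B.\<close>
  moreover have "x * coeff q j \<in> base_ring" for j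
  proof -
    have "x \<in> v_closure B"
      by (simp add: x fract_module.span_base)
    moreover have "coeff q j \<in> ideal_inverse B"
      using B_inv prods by (simp add: mult.commute)
    ultimately show ?thesis
      by (simp add: v_closure_def ideal_inverse_def)
  qed
  ultimately show "rescalable p q"
    unfolding rescalable_def using \<open>x \<noteq> 0\<close>
    by (intro exI[of _ "inverse x"]) (simp add: polys_over_def)
qed



theorem theorem3p7:
  shows "((\<forall>f :: 'a::idom poly. degree f > 0 \<longrightarrow> irreducible f \<longrightarrow> irreducible (fract_poly f))
            \<longleftrightarrow> AP_domain TYPE('a poly)) \<and>
         (AP_domain TYPE('a poly) \<longleftrightarrow> GL_domain TYPE('a poly)) \<and>
         (GL_domain TYPE('a poly) \<longleftrightarrow>
            PSP_property TYPE('a) \<and>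
            integrally_closed TYPE('a) \<and>
            (\<forall>B C :: 'a fract set.
               fin_gen_fractional_ideal B \<longrightarrow> B \<noteq> {0} \<longrightarrow>
               fin_gen_fractional_ideal C \<longrightarrow> C \<noteq> {0} \<longrightarrow>
               v_closure (ideal_prod B C) = range to_fract \<longrightarrow>
               principal_fractional_ideal (v_closure B)))"
proof -
  let ?irr = "\<forall>f :: 'a poly. degree f > 0 \<longrightarrow> irreducible f \<longrightarrow> irreducible (fract_poly f)"
  let ?principal = "\<forall>B C :: 'a fract set.
     fin_gen_fractional_ideal B \<longrightarrow> B \<noteq> {0} \<longrightarrow> fin_gen_fractional_ideal C \<longrightarrow> C \<noteq> {0} \<longrightarrow>
     v_closure (ideal_prod B C) = range to_fract \<longrightarrow> principal_fractional_ideal (v_closure B)"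
  let ?L = "primitive_factors_rescalable TYPE('a)"
  \<comment> \<open>The Gauss property \<open>?L\<close> lies on the cycle from (1) to (3) to (2)
    and back to (1), and it is equivalent to (4).\<close>
  have 1: "?irr \<Longrightarrow> ?L"
    unfolding primitive_factors_rescalable_def using irreducible_fract_imp_rescalable by blast
  have 2: "?L \<Longrightarrow> GL_domain TYPE('a poly)"
    by (rule rescalable_imp_GL_domain_poly)
  have 3: "GL_domain TYPE('a poly) \<Longrightarrow> AP_domain TYPE('a poly)"
    by (rule GL_domain_imp_AP_domain)
  have 4: "AP_domain TYPE('a poly) \<Longrightarrow> ?irr"
    using AP_domain_imp_irreducible_fract_poly by blast
  have 5: "?L \<Longrightarrow> PSP_property TYPE('a) \<and> integrally_closed TYPE('a) \<and> ?principal"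
    using rescalable_imp_PSP_property rescalable_imp_integrally_closed
      rescalable_imp_v_invertible_principal by blast
  have 6: "PSP_property TYPE('a) \<and> integrally_closed TYPE('a) \<and> ?principal \<Longrightarrow> ?L"
    by (rule v_invertible_principal_imp_rescalable) blast+
  show ?thesis
    using 1 2 3 4 5 6 by argo
qed

end
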